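(* Let $\mu$ be a positive measure on a measurable space $(\Omega,\mathcal B)$ whose range $\{\mu(A):A\in\mathcal B\}$ is a finite interval, and let $\nu$ be a signed measure on $(\Omega,\mathcal B)$ satisfying condition $(\mathcal L)$ with respect to $\mu$. Suppose that either $\nu$ is positive, or $\nu$ is a signed measure with $\frac{d\nu}{d\mu}\in L_\infty(\mu)$. Then $\nu=\alpha\mu$ for some constant $\alpha\in\mathbb R$.
   Context: A signed measure $\nu$ satisfies condition $(\mathcal L)$ with respect to $\mu$ if for all $A,B\in\mathcal B$ with $\mu(A)=\mu(B)\neq\pm\infty$ one has $\nu(A)=\nu(B)\neq\pm\infty$. (In particular, taking $A=\emptyset$, $\nu\ll\mu$, and $\frac{d\nu}{d\mu}$ denotes the Radon–Nikodym derivative.) *)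

theory Defs
  imports "HOL-Analysis.Analysis"
begin

definition signed_measure :: "'a measure \<Rightarrow> ('a set \<Rightarrow> real) \<Rightarrow> bool" where
  "signed_measure M \<nu> \<longleftrightarrow>
     \<nu> {} = 0 \<and>
     (\<forall>A :: nat \<Rightarrow> 'a set. range A \<subseteq> sets M \<longrightarrow> disjoint_family A \<longrightarrow>
        (\<lambda>i. \<nu> (A i)) sums \<nu> (\<Union>i. A i))"

definition condition_L :: "'a measure \<Rightarrow> ('a set \<Rightarrow> real) \<Rightarrow> bool" where
  "condition_L M \<nu> \<longleftrightarrow>
     (\<forall>A\<in>sets M. \<forall>B\<in>sets M. emeasure M A = emeasure M B \<and> emeasure M A \<noteq> \<infinity> \<longrightarrow> \<nu> A = \<nu> B)"

end

theory Submission
  imports Defs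
begin

text \<open>
  If \<open>\<nu>\<close> has a density bounded by \<open>C\<close>, then \<open>C \<mu> - \<nu>\<close> is a positive measure that still satisfies
  condition \<open>(L)\<close>, so assume \<open>\<nu> \<ge> 0\<close>. Cut the space into pieces \<open>X\<^sub>0, X\<^sub>1, \<dots>\<close> such that every piece has
  at most the total mass of the later ones. Put \<open>a\<^sub>n = \<mu> X\<^sub>n\<close>, \<open>b\<^sub>n = \<nu> X\<^sub>n\<close>. By Kakeya's greedy expansion every
  \<open>t \<in> [0, \<mu> \<Omega>]\<close> is a sum of some of the \<open>a\<^sub>n\<close>, and by \<open>(L)\<close> the corresponding sum of the \<open>b\<^sub>n\<close> is a function
  \<open>\<phi> t\<close>, which turns out to be increasing. Every \<open>a\<^sub>n\<close> is a sum of later \<open>a\<^sub>k\<close>, so \<open>b\<^sub>k / a\<^sub>k \<ge> b\<^sub>n / a\<^sub>n\<close> for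
  arbitrarily late \<open>k\<close>; and for each \<open>t\<close> and \<open>k\<close> either \<open>\<phi> (t + a\<^sub>k) = \<phi> t + b\<^sub>k\<close> or
  \<open>\<phi> (t - a\<^sub>k) = \<phi> t - b\<^sub>k\<close>. Vitali's covering theorem therefore gives \<open>\<nu> \<Omega> \<ge> (b\<^sub>n / a\<^sub>n) \<mu> \<Omega>\<close> for all \<open>n\<close>,
  and summing over \<open>n\<close> forces equality everywhere.
\<close>

section \<open>Monotone functions and Vitali covers of an interval\<close>

text \<open>Induction on the number of intervals: split off the one with the largest right end. The
  others lie to the left of its left end \<open>u\<close>, so the induction hypothesis applies on
  \<open>{p..u}\<close>.\<close>

lemma sum_disjoint_increments_le:
  fixes \<phi> :: "real \<Rightarrow> real"
  assumes "finite F" and "p \<le> q"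
    and mono: "\<And>s t. p \<le> s \<Longrightarrow> s \<le> t \<Longrightarrow> t \<le> q \<Longrightarrow> \<phi> s \<le> \<phi> t"
    and "\<And>u v. (u, v) \<in> F \<Longrightarrow> p \<le> u \<and> u \<le> v \<and> v \<le> q"
    and "pairwise (\<lambda>i j. disjnt {fst i..snd i} {fst j..snd j}) F"
  shows "(\<Sum>(u, v)\<in>F. \<phi> v - \<phi> u) \<le> \<phi> q - \<phi> p"
  using assms
proof (induction "card F" arbitrary: F q)
  case 0
  then show ?case by simp
next
  case (Suc n)
  then have "F \<noteq> {}" by auto
  have "Max (snd ` F) \<in> snd ` F"
    using \<open>F \<noteq> {}\<close> Suc.prems(1) by (intro Max_in) auto
  then obtain i where i: "i \<in> F" "Max (snd ` F) = snd i" by blast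
  have i_max: "snd j \<le> snd i" if "j \<in> F" for j
    using that Suc.prems(1) i(2)[symmetric] by simp
  obtain u v where uv: "i = (u, v)" by fastforce
  have uvF: "p \<le> u" "u \<le> v" "v \<le> q" using Suc.prems(4) i uv by auto
  \<comment> \<open>Since \<open>v' \<le> v\<close>, a right end \<open>v'\<close> beyond
    \<open>u\<close> would be a common point of two disjoint intervals.\<close>
  have below: "v' \<le> u" if "(u', v') \<in> F - {i}" for u' v'
  proof (rule ccontr)
    assume "\<not> v' \<le> u"
    moreover have "v' \<le> v" using i_max[of "(u', v')"] that uv by auto
    moreover have "u' \<le> v'" using Suc.prems(4) that by auto
    ultimately have "v' \<in> {u..v}" "v' \<in> {u'..v'}" by auto
    moreover have "disjnt {u..v} {u'..v'}"
      using pairwiseD[OF Suc.prems(5) i(1), of "(u', v')"] that uv by auto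
    ultimately show False by (auto simp: disjnt_iff)
  qed
  have "(\<Sum>(u, v)\<in>F - {i}. \<phi> v - \<phi> u) \<le> \<phi> u - \<phi> p"
  proof (rule Suc.hyps(1))
    show "n = card (F - {i})" using Suc.hyps(2) Suc.prems(1) i by simp
    show "pairwise (\<lambda>i j. disjnt {fst i..snd i} {fst j..snd j}) (F - {i})"
      using Suc.prems(5) by (rule pairwise_subset) auto
    show "p \<le> u' \<and> u' \<le> v' \<and> v' \<le> u" if "(u', v') \<in> F - {i}" for u' v'
      using below[OF that] Suc.prems(4)[of u' v'] that by auto
    show "\<phi> s \<le> \<phi> t" if "p \<le> s" "s \<le> t" "t \<le> u" for s t
      using Suc.prems(3) that uvF by auto
  qed (use Suc.prems(1) uvF in auto)
  moreover have "(\<Sum>(u, v)\<in>F. \<phi> v - \<phi> u) = (\<phi> v - \<phi> u) + (\<Sum>(u, v)\<in>F - {i}. \<phi> v - \<phi> u)"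
    using i(1) Suc.prems(1) uv by (simp add: sum.remove)
  moreover have "\<phi> v \<le> \<phi> q" using Suc.prems(3) uvF by auto
  ultimately show ?case by simp
qed

text \<open>The steep intervals form a Vitali cover, so countably many disjoint ones fill
  \<open>{p..q}\<close> up to a null set. On each of them \<open>\<phi>\<close> grows by at least
  \<open>c\<close> times the length, and monotonicity bounds the total growth by
  \<open>\<phi> q - \<phi> p\<close>.\<close>

lemma mono_increment_ge_of_steep_intervals:
  fixes \<phi> :: "real \<Rightarrow> real"
  assumes "p \<le> q" "0 < c"
    and mono: "\<And>s t. p \<le> s \<Longrightarrow> s \<le> t \<Longrightarrow> t \<le> q \<Longrightarrow> \<phi> s \<le> \<phi> t"
    and steep: "\<And>s d. s \<in> {p..q} \<Longrightarrow> 0 < d \<Longrightarrow>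
      \<exists>u v. p \<le> u \<and> u < v \<and> v \<le> q \<and> v - u < d \<and> s \<in> {u..v} \<and> c * (v - u) \<le> \<phi> v - \<phi> u"
  shows "c * (q - p) \<le> \<phi> q - \<phi> p"
proof -
  define K where "K = {(u, v). p \<le> u \<and> u < v \<and> v \<le> q \<and> c * (v - u) \<le> \<phi> v - \<phi> u}"
  \<comment> \<open>Centre and radius, because the covering theorem is stated for balls.\<close>
  define a :: "real \<times> real \<Rightarrow> real" where "a i = (fst i + snd i) / 2" for i
  define r :: "real \<times> real \<Rightarrow> real" where "r i = (snd i - fst i) / 2" for i
  have cball: "cball (a i) (r i) = {fst i..snd i}" for i
    unfolding cball_eq_atLeastAtMost a_def r_def by (simp add: field_simps)
  obtain C where C: "countable C" "C \<subseteq> K"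
     and pw: "pairwise (\<lambda>i j. disjnt (cball (a i) (r i)) (cball (a j) (r j))) C"
     and neg: "negligible ({p..q} - (\<Union>i \<in> C. cball (a i) (r i)))"
  proof (rule Vitali_covering_theorem_cballs[of K r "{p..q}" a])
    show "0 < r i" if "i \<in> K" for i
      using that by (auto simp: K_def r_def)
    show "\<exists>i. i \<in> K \<and> s \<in> cball (a i) (r i) \<and> r i < d" if "s \<in> {p..q}" "0 < d" for s d
    proof -
      obtain u v where uv: "p \<le> u" "u < v" "v \<le> q" "v - u < d" "s \<in> {u..v}" "c * (v - u) \<le> \<phi> v - \<phi> u"
        using steep[OF \<open>s \<in> {p..q}\<close> \<open>0 < d\<close>] by blast
      then have "(u, v) \<in> K" "s \<in> cball (a (u, v)) (r (u, v))" "r (u, v) < d"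
        unfolding cball by (auto simp: K_def r_def)
      then show ?thesis by blast
    qed
  qed blast
  define U where "U = (\<Union>i\<in>C. {fst i..snd i})"
  have bound: "measure lebesgue (\<Union>i\<in>F. {fst i..snd i}) \<le> (\<phi> q - \<phi> p) / c"
    if F: "F \<subseteq> C" "finite F" for F
  proof -
    have "measure lebesgue (\<Union>i\<in>F. {fst i..snd i}) \<le> (\<Sum>i\<in>F. measure lebesgue {fst i..snd i})"
      by (rule measure_UNION_le) (use F in auto)
    also have "\<dots> = (\<Sum>(u, v)\<in>F. v - u)"
      using F C(2) by (intro sum.cong) (auto simp: K_def)
    also have "\<dots> \<le> (\<Sum>(u, v)\<in>F. (\<phi> v - \<phi> u) / c)"
      using F C(2) \<open>0 < c\<close> by (intro sum_mono) (auto simp: K_def field_simps)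
    also have "\<dots> = (\<Sum>(u, v)\<in>F. \<phi> v - \<phi> u) / c"
      by (simp add: sum_divide_distrib case_prod_beta)
    also have "\<dots> \<le> (\<phi> q - \<phi> p) / c"
    proof -
      have "(\<Sum>(u, v)\<in>F. \<phi> v - \<phi> u) \<le> \<phi> q - \<phi> p"
      proof (rule sum_disjoint_increments_le[OF F(2) \<open>p \<le> q\<close> mono])
        show "pairwise (\<lambda>i j. disjnt {fst i..snd i} {fst j..snd j}) F"
          using pw F(1) unfolding cball by (rule pairwise_subset)
      qed (use F(1) C(2) in \<open>force simp: K_def\<close>)+
      then show ?thesis using \<open>0 < c\<close> by (simp add: divide_right_mono)
    qed
    finally show ?thesis .
  qed
  have U_sub: "U \<subseteq> {p..q}"
    using C(2) unfolding U_def by (force simp: K_def)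
  have U_meas: "U \<in> lmeasurable"
    by (rule fmeasurableI2[OF _ U_sub]) (use C(1) in \<open>auto simp: U_def\<close>)
  \<comment> \<open>The bound on finite subfamilies passes to the countable union, whose measure is
    approximated from below by finite subunions.\<close>
  have "measure lebesgue U \<le> (\<phi> q - \<phi> p) / c"
  proof (rule field_le_epsilon)
    fix e :: real assume "0 < e"
    define \<D> where "\<D> = (\<lambda>i. {fst i..snd i}) ` C"
    have bound': "measure lebesgue (\<Union>D') \<le> (\<phi> q - \<phi> p) / c" if D': "D' \<subseteq> \<D>" "finite D'" for D'
    proof -
      obtain F where "F \<subseteq> C" "finite F" "D' = (\<lambda>i. {fst i..snd i}) ` F"
        using finite_subset_image[OF D'(2) D'(1)[unfolded \<D>_def]] by blast
      then show ?thesis using bound[of F] by simp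
    qed
    obtain D' where "D' \<subseteq> \<D>" "finite D'" "measure lebesgue (\<Union>\<D>) - e < measure lebesgue (\<Union>D')"
      by (rule measure_countable_Union_approachable[of \<D> e "(\<phi> q - \<phi> p) / c"])
        (use C(1) \<open>0 < e\<close> bound' in \<open>auto simp: \<D>_def\<close>)
    then have "measure lebesgue (\<Union>\<D>) \<le> (\<phi> q - \<phi> p) / c + e"
      using bound'[of D'] by linarith
    then show "measure lebesgue U \<le> (\<phi> q - \<phi> p) / c + e"
      by (simp add: \<D>_def U_def)
  qed
  moreover have "q - p \<le> measure lebesgue U"
  proof -
    have "measure lebesgue {p..q} = measure lebesgue U"
      by (rule measure_negligible_symdiff)
        (use U_meas U_sub neg in \<open>auto simp: U_def cball Diff_eq_empty_iff[THEN iffD2]\<close>)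
    then show ?thesis using \<open>p \<le> q\<close> by simp
  qed
  ultimately have "q - p \<le> (\<phi> q - \<phi> p) / c" by simp
  then show ?thesis using \<open>0 < c\<close> by (simp add: field_simps)
qed

section \<open>Differences and tails of unordered sums\<close>

lemma has_sum_diff_real:
  fixes f g :: "'i \<Rightarrow> real"
  assumes "(f has_sum x) A" "(g has_sum y) A"
  shows "((\<lambda>i. f i - g i) has_sum (x - y)) A"
  using has_sum_add[OF assms(1) has_sum_uminus[THEN iffD2], of g "- y"] assms(2) by simp

lemma tail_infsum_tendsto_0:
  fixes f :: "nat \<Rightarrow> real"
  assumes "f summable_on UNIV"
  shows "(\<lambda>n. infsum f {n..}) \<longlonglongrightarrow> 0"
proof -
  have "infsum f {n..} = infsum f UNIV - sum f {..<n}" for n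
  proof -
    have "infsum f ({..<n} \<union> {n..}) = infsum f {..<n} + infsum f {n..}"
      by (rule infsum_Un_disjoint) (use assms in \<open>auto intro: summable_on_subset_banach\<close>)
    moreover have "{..<n} \<union> {n..} = UNIV" by auto
    ultimately show ?thesis by simp
  qed
  moreover have "(\<lambda>n. infsum f UNIV - sum f {..<n}) \<longlonglongrightarrow> infsum f UNIV - infsum f UNIV"
    using has_sum_imp_sums[OF has_sum_infsum[OF assms]] unfolding sums_def
    by (intro tendsto_intros)
  ultimately show ?thesis by simp
qed

section \<open>Kakeya expansions and the induced function \<open>\<phi>\<close>\<close>

text \<open>The numbers \<open>a n\<close> and \<open>b n\<close> stand for the two measures of the
  \<open>n\<close>-th piece. \<open>a_le_tail\<close> is Kakeya's condition, which makes the subsums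
  of \<open>a\<close> fill an interval; \<open>b_cong\<close> is condition (L) for unions of
  pieces.\<close>

locale kakeya =
  fixes a b :: "nat \<Rightarrow> real"
  assumes a_nonneg: "0 \<le> a n" and b_nonneg: "0 \<le> b n"
    and a_summable: "a summable_on UNIV" and b_summable: "b summable_on UNIV"
    and a_le_tail: "a n \<le> infsum a {Suc n..}"
    and b_cong: "infsum a I = infsum a J \<Longrightarrow> infsum b I = infsum b J"
begin

lemma a_summable_on [simp]: "a summable_on I"
  using a_summable by (rule summable_on_subset_banach) simp

lemma b_summable_on [simp]: "b summable_on I"
  using b_summable by (rule summable_on_subset_banach) simp

lemma infsum_a_insert: "n \<notin> I \<Longrightarrow> infsum a (insert n I) = a n + infsum a I"
  using infsum_Un_disjoint[of a "{n}" I] by simp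

lemma infsum_b_insert: "n \<notin> I \<Longrightarrow> infsum b (insert n I) = b n + infsum b I"
  using infsum_Un_disjoint[of b "{n}" I] by simp

lemma infsum_a_mono: "I \<subseteq> J \<Longrightarrow> infsum a I \<le> infsum a J"
  by (rule infsum_mono2) (auto simp: a_nonneg)

lemma infsum_b_mono: "I \<subseteq> J \<Longrightarrow> infsum b I \<le> infsum b J"
  by (rule infsum_mono2) (auto simp: b_nonneg)

lemma tail_a_Suc: "infsum a {n..} = a n + infsum a {Suc n..}"
proof -
  have "{n..} = insert n {Suc n..}" by auto
  then show ?thesis using infsum_a_insert[of n "{Suc n..}"] by simp
qed

text \<open>A lazy greedy choice: the term \<open>a (k + n)\<close> is taken only if the later terms
  cannot make up the remainder \<open>r k\<close>. Then \<open>r k\<close> exceeds a tail that is at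
  least \<open>a (k + n)\<close>, so \<open>r\<close> stays nonnegative; it also stays below the
  tails \<open>T k\<close>, which tend to 0.\<close>

lemma exists_infsum_a_eq:
  assumes "0 \<le> t" "t \<le> infsum a {n..}"
  obtains I where "I \<subseteq> {n..}" "infsum a I = t"
proof -
  define T where "T k = infsum a {k + n..}" for k
  define r where "r = rec_nat t (\<lambda>k x. if x \<le> T (Suc k) then x else x - a (k + n))"
  have r_0: "r 0 = t" and r_Suc: "r (Suc k) = (if r k \<le> T (Suc k) then r k else r k - a (k + n))" for k
    by (simp_all add: r_def)
  have T_Suc: "T k = a (k + n) + T (Suc k)" for k
    using tail_a_Suc[of "k + n"] by (simp add: T_def)
  have r_bounds: "0 \<le> r k \<and> r k \<le> T k" for k
  proof (induction k)
    case 0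
    then show ?case using assms by (simp add: r_0 T_def)
  next
    case (Suc k)
    then show ?case using T_Suc[of k] a_le_tail[of "k + n"] by (auto simp: r_Suc T_def)
  qed
  define J where "J = {k. \<not> r k \<le> T (Suc k)}"
  have "(\<lambda>k. T k) \<longlonglongrightarrow> 0"
    unfolding T_def using LIMSEQ_ignore_initial_segment[OF tail_infsum_tendsto_0[OF a_summable]] .
  then have r_lim: "r \<longlonglongrightarrow> 0"
    by (rule tendsto_sandwich[OF _ _ tendsto_const, rotated 2]) (use r_bounds in auto)
  define f where "f k = (if k \<in> J then a (k + n) else 0)" for k
  \<comment> \<open>The chosen terms are the drops of the remainder, so their sum telescopes to
    \<open>t\<close>.\<close>
  have "f = (\<lambda>k. r k - r (Suc k))"
    by (simp add: f_def J_def r_Suc fun_eq_iff)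
  then have "f sums (t - 0)"
    using telescope_sums'[OF r_lim] r_0 by simp
  then have "(f has_sum t) UNIV"
    by (intro sums_nonneg_imp_has_sum) (auto simp: f_def a_nonneg)
  then have "infsum f UNIV = t" by (rule infsumI)
  moreover have "infsum f UNIV = infsum (a \<circ> (\<lambda>k. k + n)) J"
    by (rule infsum_cong_neutral) (auto simp: f_def)
  moreover have "\<dots> = infsum a ((\<lambda>k. k + n) ` J)"
    by (rule infsum_reindex[symmetric]) (auto simp: inj_on_def)
  ultimately show ?thesis
    by (intro that[of "(\<lambda>k. k + n) ` J"]) auto
qed

text \<open>By \<open>b_cong\<close> the choice of \<open>I\<close> does not affect the value. Where
  \<open>t\<close> is no subsum of \<open>a\<close> the value is arbitrary, but still a subsum of
  \<open>b\<close> and hence nonnegative.\<close>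

definition \<phi> :: "real \<Rightarrow> real"
  where "\<phi> t = infsum b (SOME I. infsum a I = t)"

lemma \<phi>_infsum: "\<phi> (infsum a I) = infsum b I"
  unfolding \<phi>_def by (rule b_cong) (rule someI[of _ I], rule refl)

lemma \<phi>_nonneg: "0 \<le> \<phi> t"
  unfolding \<phi>_def by (rule infsum_nonneg) (rule b_nonneg)

lemma \<phi>_a: "\<phi> (a n) = b n"
  using \<phi>_infsum[of "{n}"] by simp

lemma \<phi>_le_tail: "0 \<le> t \<Longrightarrow> t \<le> infsum a {n..} \<Longrightarrow> \<phi> t \<le> infsum b {n..}"
  by (metis \<phi>_infsum exists_infsum_a_eq infsum_b_mono)

lemma \<phi>_add_a:
  assumes "0 \<le> t" "t \<le> infsum a {Suc n..}"
  shows "\<phi> (a n + t) = b n + \<phi> t"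
proof -
  obtain I where I: "I \<subseteq> {Suc n..}" "infsum a I = t"
    using exists_infsum_a_eq assms by blast
  then have "n \<notin> I" by auto
  then show ?thesis
    using I(2) \<phi>_infsum[of "insert n I"] \<phi>_infsum[of I] by (simp add: infsum_a_insert infsum_b_insert)
qed

text \<open>Monotonicity up to a tail of \<open>b\<close>, which \<open>\<phi>_mono\<close> then
  sends to 0. Each induction step settles the index \<open>n\<close>: either \<open>s\<close> and
  \<open>t\<close> both have expansions beyond \<open>n\<close>, or \<open>a n\<close> can be
  subtracted from both, or \<open>a n\<close> lies between them.\<close>

lemma \<phi>_almost_mono:
  assumes "0 \<le> s" "s \<le> t" "t \<le> infsum a {n..}"
  shows "\<phi> s \<le> \<phi> t + infsum b {n + j..}"
  using assms
proof (induction j arbitrary: n s t)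
  case 0
  then show ?case
    using \<phi>_le_tail[of s n] \<phi>_nonneg[of t] by simp
next
  case (Suc j)
  have IH: "\<phi> s \<le> \<phi> t + infsum b {n + Suc j..}"
    if "0 \<le> s" "s \<le> t" "t \<le> infsum a {Suc n..}" for s t
    using Suc.IH[of s t "Suc n"] that by simp
  consider "t \<le> infsum a {Suc n..}" | "a n \<le> s" | "infsum a {Suc n..} \<le> t" "s \<le> a n" by linarith
  then show ?case
  proof cases
    case 1
    then show ?thesis using IH Suc.prems by simp
  next
    case 2
    have t': "t - a n \<le> infsum a {Suc n..}"
      using Suc.prems(3) tail_a_Suc[of n] by simp
    then show ?thesis
      using 2 Suc.prems IH[of "s - a n" "t - a n"] \<phi>_add_a[of "s - a n" n] \<phi>_add_a[of "t - a n" n] by simp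
  next
    \<comment> \<open>Here \<open>s \<le> a n \<le> t\<close>, so the comparison goes through
      \<open>\<phi> (a n) = b n\<close>, which is at most \<open>\<phi> t\<close> because
      \<open>t\<close> has an expansion containing \<open>n\<close>.\<close>
    case 3
    have "t - a n \<le> infsum a {Suc n..}" "0 \<le> t - a n"
      using Suc.prems(3) tail_a_Suc[of n] a_le_tail[of n] 3 by simp_all
    then have "\<phi> (a n) \<le> \<phi> t"
      using \<phi>_add_a[of "t - a n" n] \<phi>_nonneg[of "t - a n"] by (simp add: \<phi>_a)
    moreover have "\<phi> s \<le> \<phi> (a n) + infsum b {n + Suc j..}"
      using IH[of s "a n"] 3 Suc.prems a_le_tail[of n] by simp
    ultimately show ?thesis by simp
  qed
qed

lemma \<phi>_mono:
  assumes "0 \<le> s" "s \<le> t" "t \<le> infsum a UNIV"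
  shows "\<phi> s \<le> \<phi> t"
proof -
  have "(\<lambda>j. \<phi> t + infsum b {j..}) \<longlonglongrightarrow> \<phi> t + 0"
    by (intro tendsto_intros tail_infsum_tendsto_0 b_summable)
  moreover have "\<phi> s \<le> \<phi> t + infsum b {j..}" for j
    using \<phi>_almost_mono[of s t 0 j] assms by (simp add: atLeast_0)
  ultimately show ?thesis
    by (intro LIMSEQ_le_const[of _ "\<phi> t"]) auto
qed

lemma b_eq_0: "a n = 0 \<Longrightarrow> b n = 0"
  using b_cong[of "{n}" "{}"] by simp

text \<open>As \<^term>\<open>a n\<close> is a sum of later terms, \<^term>\<open>b n / a n\<close> is a weighted mean of later ratios.\<close>

lemma later_ratio_ge:
  assumes "0 < a n"
  obtains (larger) k where "n < k" "0 < a k" "b n * a k \<le> b k * a n"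
proof (rule ccontr)
  assume "\<not> thesis"
  then have *: "\<not> b n * a k \<le> b k * a n" if "n < k" "0 < a k" for k
    using \<open>\<not> thesis\<close> larger[OF that] by blast
  obtain J where J: "J \<subseteq> {Suc n..}" "infsum a J = a n"
    using exists_infsum_a_eq a_le_tail assms by (metis less_imp_le)
  then have bJ: "infsum b J = b n"
    using \<phi>_infsum[of J] by (simp add: \<phi>_a)
  \<comment> \<open>If all later ratios were strictly smaller, \<open>g\<close> would be nonnegative
    on \<open>J\<close> and positive wherever \<open>a k > 0\<close>. But it sums to
    \<open>b n * a n - b n * a n = 0\<close> over \<open>J\<close>.\<close>
  define g where "g k = b n * a k - b k * a n" for k
  have g_nonneg: "0 \<le> g k" if "k \<in> J" for k
    using *[of k] that J(1) b_eq_0[of k] a_nonneg[of k] unfolding g_def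
    by (cases "a k = 0") (auto simp: subset_iff Suc_le_eq not_le less_le)
  have "(g has_sum (b n * infsum a J - infsum b J * a n)) J"
    unfolding g_def by (intro has_sum_diff_real has_sum_cmult_right has_sum_cmult_left has_sum_infsum) simp_all
  then have "(g has_sum 0) J" by (simp add: J(2) bJ)
  then have g0: "g k = 0" if "k \<in> J" for k
    using nonneg_has_sum_le_0D[of g J 0 k] g_nonneg that by auto
  have "\<exists>k\<in>J. a k \<noteq> 0"
    using J(2) assms infsum_0[of J a] by force
  then obtain k where "k \<in> J" "0 < a k" using a_nonneg by (metis less_le)
  then show False
    using g0[of k] *[of k] J(1) by (auto simp: g_def)
qed

text \<open>Iterating \<open>later_ratio_ge\<close> pushes the index beyond any \<open>N\<close>,
  and the ratio never drops on the way.\<close>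

lemma late_ratio_ge:
  assumes "0 < a n"
  obtains k where "N \<le> k" "0 < a k" "b n * a k \<le> b k * a n"
proof -
  have "\<exists>k\<ge>N. 0 < a k \<and> b n * a k \<le> b k * a n"
  proof (induction N)
    case 0
    then show ?case using assms by auto
  next
    case (Suc N)
    then obtain k where k: "N \<le> k" "0 < a k" "b n * a k \<le> b k * a n" by blast
    obtain l where l: "k < l" "0 < a l" "b k * a l \<le> b l * a k"
      using later_ratio_ge[OF k(2)] by blast
    have "b n / a n \<le> b k / a k" "b k / a k \<le> b l / a l"
      using k l assms by (simp_all add: field_simps)
    then have "b n / a n \<le> b l / a l" by simp
    then have "b n * a l \<le> b l * a n" using l assms by (simp add: field_simps)
    then show ?case using k l by (intro exI[of _ l]) auto
  qed
  then show ?thesis using that by blast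
qed

text \<open>A point \<open>infsum a I\<close> can be moved by \<open>a k\<close> to the left if \<open>k \<in> I\<close> and to the right
  otherwise, changing \<open>\<phi>\<close> by \<open>b k\<close>; so the steps with late \<open>k\<close> and \<open>b k / a k \<ge> b n / a n\<close>
  form a Vitali cover.\<close>

lemma b_mult_total_le: "b n * infsum a UNIV \<le> infsum b UNIV * a n"
proof (cases "0 < b n")
  case True
  then have an: "0 < a n" using a_nonneg[of n] b_eq_0[of n] by fastforce
  define c where "c = b n / a n"
  have c: "0 < c" using True an by (simp add: c_def)
  have "c * (infsum a UNIV - 0) \<le> \<phi> (infsum a UNIV) - \<phi> 0"
  proof (rule mono_increment_ge_of_steep_intervals)
    fix s d :: real assume s: "s \<in> {0..infsum a UNIV}" and "0 < d"
    have "a \<longlonglongrightarrow> 0"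
      using a_summable summable_LIMSEQ_zero summable_on_imp_summable by blast
    then have "\<forall>\<^sub>F k in sequentially. a k < d"
      using \<open>0 < d\<close> by (rule order_tendstoD)
    then obtain N where N: "\<And>k. N \<le> k \<Longrightarrow> a k < d"
      unfolding eventually_sequentially by blast
    obtain k where k: "N \<le> k" "0 < a k" "b n * a k \<le> b k * a n"
      using late_ratio_ge[OF an] .
    then have ck: "c * a k \<le> b k" using an by (simp add: c_def field_simps)
    obtain I where I: "infsum a I = s"
      using exists_infsum_a_eq[of s 0] s by (auto simp: atLeast_0)
    have "\<exists>u. 0 \<le> u \<and> u + a k \<le> infsum a UNIV \<and> s \<in> {u..u + a k} \<and> \<phi> (u + a k) - \<phi> u = b k"
    proof -
      \<comment> \<open>Removing \<open>k\<close> whether or not it belongs to \<open>I\<close>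
        treats both directions at once: \<open>s\<close> is the right end of the interval if
        \<open>k \<in> I\<close>, and the left end otherwise.\<close>
      define u where "u = infsum a (I - {k})"
      have u_k: "u + a k = infsum a (insert k I)"
        using infsum_a_insert[of k "I - {k}"] by (simp add: u_def)
      have "\<phi> (u + a k) - \<phi> u = b k"
        unfolding u_k unfolding u_def \<phi>_infsum using infsum_b_insert[of k "I - {k}"] by simp
      moreover have "0 \<le> u" unfolding u_def by (rule infsum_nonneg) (rule a_nonneg)
      moreover have "u + a k \<le> infsum a UNIV" "s \<le> u + a k" "u \<le> s"
        unfolding u_k unfolding u_def I[symmetric] by (auto intro: infsum_a_mono)
      ultimately show ?thesis by auto
    qed
    then obtain u where "0 \<le> u" "u + a k \<le> infsum a UNIV" "s \<in> {u..u + a k}" "\<phi> (u + a k) - \<phi> u = b k"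
      by blast
    then show "\<exists>u v. 0 \<le> u \<and> u < v \<and> v \<le> infsum a UNIV \<and> v - u < d \<and> s \<in> {u..v} \<and> c * (v - u) \<le> \<phi> v - \<phi> u"
      using ck k N[of k] by (intro exI[of _ u] exI[of _ "u + a k"]) auto
  qed (use c \<phi>_mono in \<open>auto intro: infsum_nonneg a_nonneg\<close>)
  also have "\<dots> = infsum b UNIV"
    using \<phi>_infsum[of UNIV] \<phi>_infsum[of "{}"] by simp
  finally show ?thesis using an by (simp add: c_def field_simps)
next
  case False
  then have "b n = 0" using b_nonneg[of n] by simp
  then show ?thesis by (simp add: infsum_nonneg a_nonneg b_nonneg)
qed

text \<open>The gaps in \<open>b_mult_total_le\<close> are nonnegative and sum to 0, so each of them
  vanishes.\<close>

lemma b_mult_total_eq: "b n * infsum a UNIV = infsum b UNIV * a n"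
proof -
  define g where "g k = infsum b UNIV * a k - b k * infsum a UNIV" for k
  have "(g has_sum (infsum b UNIV * infsum a UNIV - infsum b UNIV * infsum a UNIV)) UNIV"
    unfolding g_def by (intro has_sum_diff_real has_sum_cmult_right has_sum_cmult_left has_sum_infsum) simp_all
  then have "(g has_sum 0) UNIV" by simp
  then have "g n = 0"
    using nonneg_has_sum_le_0D[of g UNIV 0 n] b_mult_total_le by (auto simp: g_def)
  then show ?thesis by (simp add: g_def)
qed

lemma infsum_b_proportional: "\<exists>\<alpha>. \<forall>I. infsum b I = \<alpha> * infsum a I"
proof (cases "infsum a UNIV = 0")
  case True
  then have "infsum a I = infsum a {}" for I
    using infsum_a_mono[of I UNIV] infsum_nonneg[of I a] a_nonneg by simp
  then have "infsum b I = infsum b {}" for I by (rule b_cong)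
  then show ?thesis by (intro exI[of _ 0]) simp
next
  case False
  then have "b = (\<lambda>n. infsum b UNIV / infsum a UNIV * a n)"
    using b_mult_total_eq by (intro ext) (simp add: field_simps)
  then show ?thesis by (metis infsum_cmult_right')
qed

end

section \<open>Exhaustion and ordering of pieces in a finite measure space\<close>

lemma greedy_order:
  fixes f :: "'i \<Rightarrow> real"
  assumes "infinite (UNIV :: 'i set)" and fin: "\<And>\<epsilon>. 0 < \<epsilon> \<Longrightarrow> finite {i. \<epsilon> \<le> f i}"
    and nonneg: "\<And>i. 0 \<le> f i"
  obtains \<sigma> :: "nat \<Rightarrow> 'i" where "inj \<sigma>" "\<And>n i. i \<notin> \<sigma> ` {..<n} \<Longrightarrow> f i \<le> f (\<sigma> n)"
proof -
  have "\<exists>i. i \<notin> S \<and> (\<forall>j. j \<notin> S \<longrightarrow> f j \<le> f i)" if S: "finite S" for S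
  proof (cases "\<exists>i. i \<notin> S \<and> 0 < f i")
    case True
    then obtain i where i: "i \<notin> S" "0 < f i" by blast
    define B where "B = {j. f i \<le> f j} - S"
    have B: "finite B" "i \<in> B" using fin[OF i(2)] i by (auto simp: B_def)
    then have "Max (f ` B) \<in> f ` B" by (intro Max_in) auto
    then obtain k where k: "k \<in> B" "Max (f ` B) = f k" by auto
    have "f j \<le> f k" if "j \<notin> S" for j
    proof (cases "j \<in> B")
      case True
      then show ?thesis using B k(2)[symmetric] by simp
    next
      case False
      then have "f j \<le> f i" using that by (auto simp: B_def)
      also have "\<dots> \<le> f k" using k by (auto simp: B_def)
      finally show ?thesis .
    qed
    then show ?thesis using k by (auto simp: B_def)
  next
    case False
    obtain i where "i \<notin> S" using assms(1) S by (metis ex_new_if_finite)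
    then show ?thesis using False nonneg by (metis not_less order_trans)
  qed
  then obtain pick where pick: "pick S \<notin> S" "j \<notin> S \<Longrightarrow> f j \<le> f (pick S)" if "finite S" for S j
    by metis
  define S where "S = rec_nat {} (\<lambda>_ S. insert (pick S) S)"
  define \<sigma> where "\<sigma> n = pick (S n)" for n
  have S_0: "S 0 = {}" and S_Suc: "S (Suc n) = insert (\<sigma> n) (S n)" for n
    by (simp_all add: S_def \<sigma>_def)
  have S: "S n = \<sigma> ` {..<n}" for n
    by (induction n) (auto simp: S_0 S_Suc lessThan_Suc)
  have "\<sigma> n \<notin> \<sigma> ` {..<n}" for n
    using pick(1)[of "S n"] \<sigma>_def[of n] by (simp add: S)
  then have "inj \<sigma>"
    by (intro linorder_injI) (metis imageI lessThan_iff)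
  moreover have "f i \<le> f (\<sigma> n)" if "i \<notin> \<sigma> ` {..<n}" for n i
    using pick(2)[of "S n" i] \<sigma>_def[of n] that by (simp add: S)
  ultimately show ?thesis using that by blast
qed

context finite_measure
begin

lemma measure_disjoint_tendsto_0:
  assumes "range X \<subseteq> sets M" "disjoint_family X"
  shows "(\<lambda>n. measure M (X n)) \<longlonglongrightarrow> 0"
  using finite_measure_UNION[OF assms] by (intro summable_LIMSEQ_zero) (rule sums_summable)

text \<open>Exhaustion: each \<open>X n\<close> has at least half the mass of any admissible subset
  of the current remainder. As the masses of disjoint sets tend to 0, a set that stays admissible
  forever is null. \<open>P\<close> sees the remainder because admissibility may depend on
  it.\<close>

lemma greedy_disjoint_sequence:
  assumes A: "A \<in> sets M" and empty: "\<And>R. R \<in> sets M \<Longrightarrow> P R {}"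
  obtains X :: "nat \<Rightarrow> 'a set"
  where "range X \<subseteq> sets M" "disjoint_family X" "\<And>n. X n \<subseteq> A"
    and "\<And>n. P (A - (\<Union>k<n. X k)) (X n)"
    and "\<And>Y. Y \<in> sets M \<Longrightarrow> Y \<subseteq> A - (\<Union>k. X k) \<Longrightarrow> (\<And>n. P (A - (\<Union>k<n. X k)) Y)
      \<Longrightarrow> measure M Y = 0"
proof -
  let ?ok = "\<lambda>R Y. Y \<in> sets M \<and> Y \<subseteq> R \<and> P R Y"
  have "\<exists>X. ?ok R X \<and> (\<forall>Y. ?ok R Y \<longrightarrow> measure M Y \<le> 2 * measure M X)" if R: "R \<in> sets M" for R
  proof -
    define s where "s = (SUP Y\<in>Collect (?ok R). measure M Y)"
    have bdd: "bdd_above (measure M ` Collect (?ok R))"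
      using bounded_measure by (intro bdd_aboveI) auto
    have le_s: "measure M Y \<le> s" if "?ok R Y" for Y
      unfolding s_def using bdd that by (intro cSUP_upper) auto
    show ?thesis
    proof (cases "s \<le> 0")
      case True
      then have "measure M Y \<le> 2 * measure M {}" if "?ok R Y" for Y
        using le_s[OF that] by simp
      moreover have "?ok R {}" using empty R by simp
      ultimately show ?thesis by blast
    next
      case False
      then have "s / 2 < s" by simp
      moreover have "Collect (?ok R) \<noteq> {}" using empty R by blast
      ultimately obtain X where "?ok R X" "s / 2 < measure M X"
        unfolding s_def using less_cSUP_iff[OF _ bdd] s_def by (metis (no_types, lifting) mem_Collect_eq)
      then show ?thesis using le_s by (intro exI[of _ X]) fastforce
    qed
  qed
  then obtain pick where pick: "?ok R (pick R)" "?ok R Y \<Longrightarrow> measure M Y \<le> 2 * measure M (pick R)"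
    if "R \<in> sets M" for R Y
    by metis
  define R where "R = rec_nat A (\<lambda>_ R. R - pick R)"
  define X where "X n = pick (R n)" for n
  have R_0: "R 0 = A" and R_Suc: "R (Suc n) = R n - X n" for n
    by (simp_all add: R_def X_def)
  have R_sets: "R n \<in> sets M" for n
  proof (induction n)
    case 0
    then show ?case using A by (simp add: R_0)
  next
    case (Suc n)
    then show ?case using pick(1)[of "R n"] by (auto simp: R_Suc X_def)
  qed
  have X: "?ok (R n) (X n)" and X_max: "?ok (R n) Y \<Longrightarrow> measure M Y \<le> 2 * measure M (X n)" for n Y
    using pick[OF R_sets[of n]] by (auto simp: X_def)
  have R: "R n = A - (\<Union>k<n. X k)" for n
    by (induction n) (auto simp: R_0 R_Suc lessThan_Suc)
  have X_sub: "X n \<subseteq> A" for n using X[of n] by (auto simp: R)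
  have disj: "disjoint_family X"
  proof -
    have "X m \<inter> X n = {}" if "m < n" for m n
      using X[of n] that by (auto simp: R)
    then show ?thesis
      unfolding disjoint_family_on_def by (metis Int_commute linorder_neqE_nat)
  qed
  have X_sets: "range X \<subseteq> sets M" using X by auto
  show ?thesis
  proof (rule that[OF X_sets disj X_sub])
    show "P (A - (\<Union>k<n. X k)) (X n)" for n using X[of n] by (simp add: R)
    show "measure M Y = 0"
      if Y: "Y \<in> sets M" "Y \<subseteq> A - (\<Union>k. X k)" "\<And>n. P (A - (\<Union>k<n. X k)) Y" for Y
    proof -
      have "measure M Y \<le> 2 * measure M (X n)" for n
        by (rule X_max) (use Y in \<open>auto simp: R\<close>)
      moreover have "(\<lambda>n. 2 * measure M (X n)) \<longlonglongrightarrow> 2 * 0"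
        by (intro tendsto_intros measure_disjoint_tendsto_0 X_sets disj)
      ultimately have "measure M Y \<le> 2 * 0"
        by (intro LIMSEQ_le_const[where a = "measure M Y"]) blast+
      then show ?thesis using measure_nonneg[of M Y] by simp
    qed
  qed
qed

text \<open>Null sets are irreducible in this sense; the other irreducible sets are the atoms.\<close>

definition irreducible_set :: "'a set \<Rightarrow> bool" where
  "irreducible_set A \<longleftrightarrow> (\<forall>Y\<in>sets M. Y \<subseteq> A \<longrightarrow> measure M Y = 0 \<or> measure M Y = measure M A)"

text \<open>Two exhaustions. The first removes irreducible sets until the rest \<open>D\<close> has
  none of positive mass; the second cuts from \<open>D\<close> pieces of at most half the remaining
  mass, so that each is dominated by what it leaves.\<close>

lemma atoms_and_halving_pieces:
  obtains H E :: "nat \<Rightarrow> 'a set"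
  where "range H \<subseteq> sets M" "disjoint_family H" "\<And>i. irreducible_set (H i)"
    and "range E \<subseteq> sets M" "disjoint_family E" "\<And>i j. H i \<inter> E j = {}"
    and "\<And>n. measure M (E n) \<le> measure M (space M - (\<Union>i. H i) - (\<Union>k\<le>n. E k))"
    and "measure M (space M - (\<Union>i. H i) - (\<Union>i. E i)) = 0"
proof -
  obtain H :: "nat \<Rightarrow> 'a set"
    where H: "range H \<subseteq> sets M" "disjoint_family H" "\<And>i. irreducible_set (H i)"
    and H_max: "\<And>Y. Y \<in> sets M \<Longrightarrow> Y \<subseteq> space M - (\<Union>i. H i) \<Longrightarrow> irreducible_set Y \<Longrightarrow> measure M Y = 0"
    by (rule greedy_disjoint_sequence[of "space M" "\<lambda>_. irreducible_set"])
      (auto simp: irreducible_set_def)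
  define D where "D = space M - (\<Union>i. H i)"
  have D: "D \<in> sets M" using H(1) by (auto simp: D_def)
  obtain E :: "nat \<Rightarrow> 'a set"
    where E: "range E \<subseteq> sets M" "disjoint_family E" "\<And>i. E i \<subseteq> D"
    and E_half: "\<And>n. measure M (E n) \<le> measure M (D - (\<Union>k<n. E k)) / 2"
    and E_max: "\<And>Y. Y \<in> sets M \<Longrightarrow> Y \<subseteq> D - (\<Union>i. E i) \<Longrightarrow>
      (\<And>n. measure M Y \<le> measure M (D - (\<Union>k<n. E k)) / 2) \<Longrightarrow> measure M Y = 0"
    by (rule greedy_disjoint_sequence[OF D, of "\<lambda>R Y. measure M Y \<le> measure M R / 2"]) auto
  have E_sets: "E n \<in> sets M" for n using E(1) by auto
  have "measure M (E n) \<le> measure M (D - (\<Union>k\<le>n. E k))" for n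
  proof -
    have "measure M (D - (\<Union>k<n. E k) - E n) = measure M (D - (\<Union>k<n. E k)) - measure M (E n)"
    proof (rule finite_measure_Diff)
      have "E k \<inter> E n = {}" if "k < n" for k
        using E(2) that unfolding disjoint_family_on_def by auto
      then show "E n \<subseteq> D - (\<Union>k<n. E k)" using E(3)[of n] by auto
    qed (use D E_sets in auto)
    moreover have "D - (\<Union>k<n. E k) - E n = D - (\<Union>k\<le>n. E k)"
      by (auto simp: lessThan_Suc_atMost[symmetric] lessThan_Suc)
    ultimately show ?thesis using E_half[of n] by simp
  qed
  moreover have "measure M (D - (\<Union>i. E i)) = 0"
  proof (rule H_max)
    define R where "R = D - (\<Union>i. E i)"
    have R: "R \<in> sets M" using D E(1) by (auto simp: R_def)
    have half: "measure M Y = 0" if Y: "Y \<in> sets M" "Y \<subseteq> R" "measure M Y \<le> measure M R / 2" for Y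
    proof (rule E_max)
      fix n
      have "measure M R \<le> measure M (D - (\<Union>k<n. E k))"
        by (rule finite_measure_mono) (use D E_sets in \<open>auto simp: R_def\<close>)
      then show "measure M Y \<le> measure M (D - (\<Union>k<n. E k)) / 2" using Y(3) by simp
    qed (use Y in \<open>auto simp: R_def\<close>)
    \<comment> \<open>One of \<open>Y\<close> and \<open>R - Y\<close> has at most half the mass of
      \<open>R\<close> and is therefore null. So \<open>R\<close> is irreducible, and being part of
      \<open>D\<close> it is null.\<close>
    have "measure M Y = 0 \<or> measure M Y = measure M R" if Y: "Y \<in> sets M" "Y \<subseteq> R" for Y
    proof -
      have "measure M (R - Y) = measure M R - measure M Y"
        using R Y by (rule finite_measure_Diff)
      then show ?thesis
        using half[of Y] half[of "R - Y"] R Y by (cases "measure M Y \<le> measure M R / 2") auto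
    qed
    then show "irreducible_set (D - (\<Union>i. E i))"
      by (auto simp: irreducible_set_def R_def)
  qed (use D E(1) in \<open>auto simp: D_def\<close>)
  moreover have "H i \<inter> E j = {}" for i j
    using E(3)[of j] by (auto simp: D_def)
  ultimately show ?thesis
    using H E by (intro that[of H E]) (simp_all add: D_def)
qed

text \<open>Arrange all pieces by decreasing mass. If a piece of the atomless part has been removed, the
  remaining atomless part already dominates the current piece. Otherwise only atoms of at least the
  current mass \<open>m\<close> have been removed, and a set of measure strictly between the remaining mass
  and \<open>m\<close> could contain none of them.\<close>

lemma kakeya_decomposition:
  assumes full: "{0..measure M (space M)} \<subseteq> measure M ` sets M"
  obtains X :: "nat \<Rightarrow> 'a set"
  where "range X \<subseteq> sets M" "disjoint_family X" "measure M (space M - (\<Union>n. X n)) = 0"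
    and "\<And>n. measure M (X n) \<le> measure M (space M - (\<Union>k\<le>n. X k))"
proof -
  obtain H E :: "nat \<Rightarrow> 'a set"
    where H: "range H \<subseteq> sets M" "disjoint_family H" "\<And>i. irreducible_set (H i)"
    and E: "range E \<subseteq> sets M" "disjoint_family E" and HE: "\<And>i j. H i \<inter> E j = {}"
    and E_rest: "\<And>n. measure M (E n) \<le> measure M (space M - (\<Union>i. H i) - (\<Union>k\<le>n. E k))"
    and null: "measure M (space M - (\<Union>i. H i) - (\<Union>i. E i)) = 0"
    by (rule atoms_and_halving_pieces) blast
  define p where "p = case_sum H E"
  have p_simps [simp]: "p (Inl i) = H i" "p (Inr i) = E i" for i
    by (simp_all add: p_def)
  have p_sets [measurable]: "p i \<in> sets M" for i
    using H(1) E(1) by (cases i) auto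
  have p_disj: "p i \<inter> p j = {}" if "i \<noteq> j" for i j
    using that H(2) E(2) HE by (cases i; cases j) (auto simp: disjoint_family_on_def Int_commute)
  have fin: "finite {i. \<epsilon> \<le> measure M (p i)}" if "0 < \<epsilon>" for \<epsilon>
  proof -
    have "finite {i. \<epsilon> \<le> measure M (Y i)}" if "(\<lambda>n. measure M (Y n)) \<longlonglongrightarrow> 0" for Y :: "nat \<Rightarrow> 'a set"
      using order_tendstoD(2)[OF that \<open>0 < \<epsilon>\<close>]
      by (simp add: eventually_cofinite cofinite_eq_sequentially[symmetric] not_less)
    then have "finite (Inl ` {i. \<epsilon> \<le> measure M (H i)} \<union> Inr ` {i. \<epsilon> \<le> measure M (E i)})"
      using measure_disjoint_tendsto_0[OF H(1,2)] measure_disjoint_tendsto_0[OF E] by simp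
    moreover have "{i. \<epsilon> \<le> measure M (p i)} \<subseteq> Inl ` {i. \<epsilon> \<le> measure M (H i)} \<union> Inr ` {i. \<epsilon> \<le> measure M (E i)}"
    proof
      fix i assume "i \<in> {i. \<epsilon> \<le> measure M (p i)}"
      then show "i \<in> Inl ` {i. \<epsilon> \<le> measure M (H i)} \<union> Inr ` {i. \<epsilon> \<le> measure M (E i)}"
        by (cases i) auto
    qed
    ultimately show ?thesis by (rule finite_subset[rotated])
  qed
  obtain \<sigma> :: "nat \<Rightarrow> nat + nat" where "inj \<sigma>"
    and \<sigma>_max: "\<And>n i. i \<notin> \<sigma> ` {..<n} \<Longrightarrow> measure M (p i) \<le> measure M (p (\<sigma> n))"
    by (rule greedy_order[of "\<lambda>i. measure M (p i)"]) (use fin in auto)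
  define X where "X n = p (\<sigma> n)" for n
  have X_sets [measurable]: "X n \<in> sets M" for n by (simp add: X_def)
  have X_disj: "disjoint_family X"
    unfolding disjoint_family_on_def X_def using \<open>inj \<sigma>\<close> by (auto intro!: p_disj dest: injD)
  \<comment> \<open>A piece missed by \<open>\<sigma>\<close> is dominated by every
    \<open>X n\<close>, and these masses tend to 0.\<close>
  have unused: "measure M (p i) = 0" if "i \<notin> range \<sigma>" for i
  proof -
    have "measure M (p i) \<le> measure M (X n)" for n
      unfolding X_def by (rule \<sigma>_max) (use that in auto)
    moreover have "(\<lambda>n. measure M (X n)) \<longlonglongrightarrow> 0"
      by (rule measure_disjoint_tendsto_0[OF _ X_disj]) auto
    ultimately have "measure M (p i) \<le> 0" by (intro LIMSEQ_le_const) auto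
    then show ?thesis using measure_nonneg[of M "p i"] by simp
  qed
  have rest_null: "measure M (space M - (\<Union>n. X n)) = 0"
  proof -
    let ?N = "(space M - (\<Union>i. H i) - (\<Union>i. E i)) \<union> (\<Union>i\<in>- range \<sigma>. p i)"
    have sub: "space M - (\<Union>n. X n) \<subseteq> ?N"
    proof
      fix x assume x: "x \<in> space M - (\<Union>n. X n)"
      show "x \<in> ?N"
      proof (cases "\<exists>i. x \<in> p i")
        case True
        then obtain i where i: "x \<in> p i" by blast
        then have "i \<notin> range \<sigma>" using x by (auto simp: X_def)
        then show ?thesis using i by blast
      next
        case False
        then have "x \<notin> H i" "x \<notin> E i" for i
          using p_simps by (metis, metis)
        then show ?thesis using x by blast
      qed
    qed
    have "?N \<in> null_sets M"
    proof (intro null_sets.Un null_sets_UN')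
      show "space M - (\<Union>i. H i) - (\<Union>i. E i) \<in> null_sets M"
        using null H(1) E(1) by (auto simp: null_sets_def emeasure_eq_measure)
      show "p i \<in> null_sets M" if "i \<in> - range \<sigma>" for i
        using unused[of i] that by (auto simp: null_sets_def emeasure_eq_measure)
    qed simp
    then have "space M - (\<Union>n. X n) \<in> null_sets M"
      by (rule null_sets_subset[OF _ _ sub]) measurable
    then show ?thesis by (simp add: null_sets_def emeasure_eq_measure)
  qed
  have "measure M (X n) \<le> measure M (space M - (\<Union>k\<le>n. X k))" for n
  proof -
    define V where "V = space M - (\<Union>k\<le>n. X k)"
    have V_sets [measurable]: "V \<in> sets M" unfolding V_def by measurable
    have larger: "measure M (X n) \<le> measure M (X k)" if "k \<le> n" for k
      unfolding X_def by (rule \<sigma>_max) (use that \<open>inj \<sigma>\<close> in \<open>auto dest: injD\<close>)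
    \<comment> \<open>The indices of the pieces \<open>E l\<close> among the first
      \<open>n + 1\<close> pieces in the new order.\<close>
    define B where "B = Inr -` \<sigma> ` {..n}"
    have "finite B" unfolding B_def by (intro finite_vimageI) auto
    have B_I: "l \<in> B" if "i \<le> n" "\<sigma> i = Inr l" for i l
      unfolding B_def using that by (metis atMost_iff image_eqI vimageI)
    show ?thesis
    proof (cases "B = {}")
      case False
      \<comment> \<open>With \<open>j\<close> the largest such index, nothing of the atomless part
        beyond \<open>E j\<close> has been removed; by \<open>E_rest\<close> this part dominates
        \<open>E j\<close>, whose mass is at least that of \<open>X n\<close>.\<close>
      define j where "j = Max B"
      have "j \<in> B" using False \<open>finite B\<close> by (simp add: j_def)
      then obtain k where k: "k \<le> n" "\<sigma> k = Inr j" by (auto simp: B_def)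
      have "X i \<subseteq> (\<Union>i. H i) \<union> (\<Union>k\<le>j. E k)" if "i \<le> n" for i
      proof (cases "\<sigma> i")
        case (Inl l)
        then show ?thesis by (auto simp: X_def)
      next
        case (Inr l)
        then have "l \<in> B" using B_I that by blast
        then have "l \<le> j" using \<open>finite B\<close> by (simp add: j_def)
        then show ?thesis using Inr by (auto simp: X_def)
      qed
      then have "space M - (\<Union>i. H i) - (\<Union>k\<le>j. E k) \<subseteq> V"
        unfolding V_def by blast
      then have "measure M (space M - (\<Union>i. H i) - (\<Union>k\<le>j. E k)) \<le> measure M V"
        by (rule finite_measure_mono) measurable
      then show ?thesis
        using larger[OF k(1)] E_rest[of j] k(2) by (simp add: X_def V_def)
    next
      case True
      have irr: "irreducible_set (X k)" if "k \<le> n" for k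
      proof (cases "\<sigma> k")
        case (Inl l)
        then show ?thesis using H(3) by (simp add: X_def)
      next
        case (Inr l)
        then have "l \<in> B" using B_I that by blast
        then show ?thesis using True by simp
      qed
      show ?thesis
      proof (rule ccontr)
        assume "\<not> ?thesis"
        then obtain t where t: "measure M V < t" "t < measure M (X n)"
          unfolding V_def by (metis dense not_le)
        then obtain A where A: "A \<in> sets M" "measure M A = t"
          using subsetD[OF full, of t] measure_nonneg[of M V] bounded_measure[of "X n"] by auto
        have "measure M (A \<inter> X k) = 0" if "k \<le> n" for k
        proof (rule ccontr)
          assume "measure M (A \<inter> X k) \<noteq> 0"
          then have "measure M (A \<inter> X k) = measure M (X k)"
            using irr[OF that] A(1) by (auto simp: irreducible_set_def)
          moreover have "measure M (A \<inter> X k) \<le> measure M A"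
            by (rule finite_measure_mono) (use A in auto)
          ultimately show False using larger[OF that] t A(2) by simp
        qed
        \<comment> \<open>Up to a null set \<open>A\<close> lies in \<open>V\<close>, which is too
          small to hold mass \<open>t\<close>.\<close>
        then have "(\<Union>k\<le>n. A \<inter> X k) \<in> null_sets M"
          using A(1) by (intro null_sets_UN') (auto simp: null_sets_def emeasure_eq_measure)
        then have "measure M (V \<union> (\<Union>k\<le>n. A \<inter> X k)) = measure M V"
          by (intro measure_Un_null_set) auto
        moreover have "measure M A \<le> measure M (V \<union> (\<Union>k\<le>n. A \<inter> X k))"
          by (rule finite_measure_mono) (use A sets.sets_into_space[OF A(1)] in \<open>auto simp: V_def\<close>)
        ultimately show False using t A(2) by simp
      qed
    qed
  qed
  then show ?thesis
    using X_disj rest_null by (intro that[of X]) auto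
qed

end

section \<open>From unions of pieces to all measurable sets\<close>

text \<open>On unions of pieces proportionality comes from the locale \<open>kakeya\<close>. Every
  \<open>measure M A\<close> is also the mass of such a union, and (L) carries the formula over to
  \<open>A\<close>.\<close>

lemma (in finite_measure) condition_L_nonneg_proportional:
  assumes full: "{0..measure M (space M)} \<subseteq> measure M ` sets M"
    and signed: "signed_measure M \<nu>" and L: "condition_L M \<nu>"
    and nonneg: "\<And>A. A \<in> sets M \<Longrightarrow> 0 \<le> \<nu> A"
  obtains \<alpha> where "\<And>A. A \<in> sets M \<Longrightarrow> \<nu> A = \<alpha> * measure M A"
proof -
  have L': "\<nu> A = \<nu> B" if "A \<in> sets M" "B \<in> sets M" "measure M A = measure M B" for A B
  proof -
    have "emeasure M A = emeasure M B" using that(3) by (simp add: emeasure_eq_measure)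
    then show ?thesis using L that(1,2) unfolding condition_L_def by (metis emeasure_finite infinity_ennreal_def)
  qed
  obtain X :: "nat \<Rightarrow> 'a set"
    where X: "range X \<subseteq> sets M" "disjoint_family X" "measure M (space M - (\<Union>n. X n)) = 0"
    and X_le: "\<And>n. measure M (X n) \<le> measure M (space M - (\<Union>k\<le>n. X k))"
    by (rule kakeya_decomposition[OF full]) blast
  define a where "a n = measure M (X n)" for n
  define b where "b n = \<nu> (X n)" for n
  have X_sets [measurable]: "X n \<in> sets M" for n using X(1) by auto
  have has_sum_union: "(\<lambda>n. m (X n)) summable_on I \<and> infsum (\<lambda>n. m (X n)) I = m (\<Union>n\<in>I. X n)"
    if m: "signed_measure M m" "\<And>A. A \<in> sets M \<Longrightarrow> 0 \<le> m A" for m :: "'a set \<Rightarrow> real" and I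
  proof -
    \<comment> \<open>Padding with empty sets turns a union over \<open>I\<close> into one over all
      indices, to which countable additivity applies.\<close>
    define Y where "Y n = (if n \<in> I then X n else {})" for n
    have "range Y \<subseteq> sets M" "disjoint_family Y"
      using X(1,2) by (auto simp: Y_def disjoint_family_on_def)
    then have "(\<lambda>n. m (Y n)) sums m (\<Union>n. Y n)"
      using m(1) unfolding signed_measure_def by blast
    then have "((\<lambda>n. m (Y n)) has_sum m (\<Union>n. Y n)) UNIV"
      by (rule sums_nonneg_imp_has_sum) (auto simp: Y_def m(2))
    moreover have "(\<Union>n. Y n) = (\<Union>n\<in>I. X n)" by (auto simp: Y_def split: if_splits)
    moreover have "m {} = 0" using m(1) by (simp add: signed_measure_def)
    then have "((\<lambda>n. m (Y n)) has_sum s) UNIV \<longleftrightarrow> ((\<lambda>n. m (X n)) has_sum s) I" for s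
      by (intro has_sum_cong_neutral) (auto simp: Y_def)
    ultimately have "((\<lambda>n. m (X n)) has_sum m (\<Union>n\<in>I. X n)) I" by simp
    then show ?thesis by (auto simp: summable_on_def infsumI)
  qed
  have signed_M: "signed_measure M (measure M)"
    unfolding signed_measure_def using finite_measure_UNION by auto
  have a: "a summable_on I" "infsum a I = measure M (\<Union>n\<in>I. X n)" for I
    using has_sum_union[OF signed_M] unfolding a_def by auto
  have b: "b summable_on I" "infsum b I = \<nu> (\<Union>n\<in>I. X n)" for I
    using has_sum_union[OF signed nonneg] unfolding b_def by auto
  interpret kakeya a b
  proof
    show "0 \<le> a n" "0 \<le> b n" for n by (auto simp: a_def b_def nonneg)
    show "a n \<le> infsum a {Suc n..}" for n
    proof -
      \<comment> \<open>Up to a null set, what the first \<open>n + 1\<close> pieces leave is the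
        union of the later ones.\<close>
      have "k \<in> {..n} \<or> k \<in> {Suc n..}" for k by auto
      then have "space M - (\<Union>k\<le>n. X k) \<subseteq> (space M - (\<Union>k. X k)) \<union> (\<Union>k\<in>{Suc n..}. X k)"
        by blast
      then have "measure M (space M - (\<Union>k\<le>n. X k))
          \<le> measure M ((space M - (\<Union>k. X k)) \<union> (\<Union>k\<in>{Suc n..}. X k))"
        by (rule finite_measure_mono) measurable
      also have "\<dots> \<le> measure M (space M - (\<Union>k. X k)) + measure M (\<Union>k\<in>{Suc n..}. X k)"
        by (rule measure_Un_le) measurable
      also have "\<dots> = infsum a {Suc n..}" using X(3) a(2) by simp
      finally show ?thesis using X_le[of n] by (simp add: a_def)
    qed
    show "infsum b I = infsum b J" if "infsum a I = infsum a J" for I J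
      using that unfolding a(2) b(2) by (intro L') auto
  qed (fact a(1) b(1))+
  obtain \<alpha> where \<alpha>: "\<And>I. infsum b I = \<alpha> * infsum a I"
    using infsum_b_proportional by blast
  have total: "infsum a UNIV = measure M (space M)"
  proof -
    have "measure M (space M - (\<Union>n. X n)) = measure M (space M) - measure M (\<Union>n. X n)"
      by (rule finite_measure_compl) measurable
    then show ?thesis using X(3) a(2) by simp
  qed
  show thesis
  proof
    fix A assume A: "A \<in> sets M"
    obtain I where I: "infsum a I = measure M A"
      using exists_infsum_a_eq[of "measure M A" 0] total bounded_measure[of A] by (auto simp: atLeast_0)
    have "\<nu> A = \<nu> (\<Union>n\<in>I. X n)"
      by (rule L') (use A I in \<open>auto simp: a(2)\<close>)
    also have "\<dots> = \<alpha> * measure M A" using \<alpha>[of I] I by (simp add: b(2))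
    finally show "\<nu> A = \<alpha> * measure M A" .
  qed
qed

text \<open>The finiteness of \<open>\<nu>\<close> required in (L) is built into its real-valued
  type. The Radon-Nikodym derivative appears as an explicit density \<open>f\<close> with an almost
  everywhere bound \<open>C\<close>.\<close>

theorem theorem2p4:
  fixes M :: "'a measure" and \<nu> :: "'a set \<Rightarrow> real"
  assumes range_finite: "emeasure M (space M) < \<infinity>"
    and range_interval: "is_interval (measure M ` sets M)"
    and signed: "signed_measure M \<nu>"
    and L: "condition_L M \<nu>"
    and pos_or_bdd:
      "(\<forall>A\<in>sets M. \<nu> A \<ge> 0) \<or>
       (\<exists>f C. f \<in> borel_measurable M \<and> (AE x in M. \<bar>f x\<bar> \<le> C) \<and>
              (\<forall>A\<in>sets M. \<nu> A = (LINT x:A|M. f x)))"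
  shows "\<exists>\<alpha>::real. \<forall>A\<in>sets M. \<nu> A = \<alpha> * measure M A"
proof -
  interpret finite_measure M
    by (rule finite_measureI) (use range_finite in auto)
  have "0 \<in> measure M ` sets M" by (rule image_eqI[of _ _ "{}"]) auto
  moreover have "measure M (space M) \<in> measure M ` sets M" by auto
  ultimately have full: "{0..measure M (space M)} \<subseteq> measure M ` sets M"
    using range_interval unfolding is_interval_1 by (meson atLeastAtMost_iff subsetI)
  from pos_or_bdd show ?thesis
  proof (elim disjE exE conjE)
    assume "\<forall>A\<in>sets M. 0 \<le> \<nu> A"
    then show ?thesis
      using condition_L_nonneg_proportional[OF full signed L] by metis
  next
    fix f :: "'a \<Rightarrow> real" and C
    assume f [measurable]: "f \<in> borel_measurable M" and C: "AE x in M. \<bar>f x\<bar> \<le> C"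
      and \<nu>: "\<forall>A\<in>sets M. \<nu> A = (LINT x:A|M. f x)"
    \<comment> \<open>Nonnegative since \<open>f \<le> C\<close> almost everywhere; a constant
      \<open>\<alpha>\<close> for \<open>\<nu>'\<close> gives \<open>C - \<alpha>\<close> for
      \<open>\<nu>\<close>.\<close>
    define \<nu>' where "\<nu>' A = C * measure M A - \<nu> A" for A
    have int_f: "integrable M f"
      by (rule integrable_const_bound[of _ C]) (use C in auto)
    have "\<nu> A \<le> C * measure M A" if A [measurable]: "A \<in> sets M" for A
    proof -
      have "\<nu> A = (LINT x:A|M. f x)" using \<nu> A by blast
      also have "\<dots> \<le> (LINT x|M. indicator A x *\<^sub>R C)"
        unfolding set_lebesgue_integral_def
      proof (rule integral_mono_AE)
        show "integrable M (\<lambda>x. indicator A x *\<^sub>R f x)"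
          using A int_f by (rule integrable_mult_indicator)
        show "integrable M (\<lambda>x. indicator A x *\<^sub>R C)"
          using A by (intro integrable_mult_indicator) auto
        show "AE x in M. indicator A x *\<^sub>R f x \<le> indicator A x *\<^sub>R C"
          using C by eventually_elim (auto simp: indicator_def)
      qed
      also have "\<dots> = C * measure M A" using A by simp
      finally show ?thesis .
    qed
    then have nonneg': "0 \<le> \<nu>' A" if "A \<in> sets M" for A
      using that by (simp add: \<nu>'_def)
    have signed': "signed_measure M \<nu>'"
      unfolding signed_measure_def \<nu>'_def
    proof (intro conjI allI impI)
      show "C * measure M {} - \<nu> {} = 0" using signed by (simp add: signed_measure_def)
      show "(\<lambda>i. C * measure M (A i) - \<nu> (A i)) sums (C * measure M (\<Union>i. A i) - \<nu> (\<Union>i. A i))"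
        if A: "range A \<subseteq> sets M" "disjoint_family A" for A :: "nat \<Rightarrow> 'a set"
        using finite_measure_UNION[OF A] signed A unfolding signed_measure_def
        by (intro sums_diff sums_mult) auto
    qed
    have "measure M A = measure M B" if "emeasure M A = emeasure M B" for A B
      using that by (simp add: measure_def)
    then have L': "condition_L M \<nu>'"
      using L unfolding condition_L_def \<nu>'_def by metis
    obtain \<alpha> where "\<And>A. A \<in> sets M \<Longrightarrow> \<nu>' A = \<alpha> * measure M A"
      using condition_L_nonneg_proportional[OF full signed' L' nonneg'] by blast
    then have "\<forall>A\<in>sets M. \<nu> A = (C - \<alpha>) * measure M A"
      unfolding \<nu>'_def by (auto simp: algebra_simps)
    then show ?thesis by blast
  qed
qed

end
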